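(* Let $H$ be a hypergraph and let $M_H=(m_{ij})_{i,j\in V(H)}$ be a real square matrix indexed by $V(H)$. For any $\mathfrak{R}_{M_H}$-equivalence class $W$ with $|W|\ge 2$, there exists an eigenvalue $\lambda_W$ of $M_H$ such that $S_W$ is a subspace of the eigenspace $V_{\lambda_W}(M_H)=\{x\in\mathbb{R}^{V(H)}: M_Hx=\lambda_W x\}$.
   Context: A hypergraph $H=(V(H),E(H))$ consists of a finite nonempty vertex set $V(H)$ and a finite family $E(H)$ of nonempty subsets of $V(H)$, called hyperedges. Vectors $x\in\mathbb{R}^{V(H)}$ are functions $x:V(H)\to\mathbb{R}$, and $(M_Hx)(i)=\sum_{j\in V(H)}m_{ij}x(j)$. $\mathfrak{R}_{M_H}$ is the equivalence relation on $V(H)$ consisting of the pairs $(i,j)$ such that $m_{ii}=m_{jj}$, $m_{ij}=m_{ji}$, and $m_{ik}=m_{jk}$, $m_{ki}=m_{kj}$ for all $k\notin\{i,j\}$. For $U\subseteq V(H)$, $S_U=\{x\in\mathbb{R}^{V(H)}: \{i:x(i)\neq 0\}\subseteq U,\ \sum_{i\in U}x(i)=0\}$. *)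

theory Defs
  imports Complex_Main "HOL-Library.Function_Algebras" "HOL-Library.Multiset"
begin

text \<open>Hyperedges form a finite family, so repetitions are allowed: \<open>E\<close> is a multiset.\<close>

locale hypergraph =
  fixes V :: "'a set" and E :: "'a set multiset"
  assumes finite_vertices: "finite V"
    and vertices_nonempty: "V \<noteq> {}"
    and hyperedge: "\<And>e. e \<in># E \<Longrightarrow> e \<noteq> {} \<and> e \<subseteq> V"

text \<open>A vector indexed by \<open>V\<close> is represented by the function on the whole type that is \<open>0\<close>
  outside \<open>V\<close>; vector space operations are pointwise. A matrix indexed by \<open>V\<close> is a function
  \<open>m\<close> of which only the entries in \<open>V \<times> V\<close> are ever used.\<close>

definition vecs :: "'a set \<Rightarrow> ('a \<Rightarrow> real) set" where
  "vecs V = {x. \<forall>i. i \<notin> V \<longrightarrow> x i = 0}"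

definition vscale :: "real \<Rightarrow> ('a \<Rightarrow> real) \<Rightarrow> 'a \<Rightarrow> real" where
  "vscale c x = (\<lambda>i. c * x i)"

interpretation fun_vs: vector_space vscale
  by unfold_locales (auto simp: vscale_def fun_eq_iff algebra_simps)

definition mat_vec :: "'a set \<Rightarrow> ('a \<Rightarrow> 'a \<Rightarrow> real) \<Rightarrow> ('a \<Rightarrow> real) \<Rightarrow> 'a \<Rightarrow> real" where
  "mat_vec V m x = (\<lambda>i. if i \<in> V then \<Sum>j\<in>V. m i j * x j else 0)"

definition eigenspace :: "'a set \<Rightarrow> ('a \<Rightarrow> 'a \<Rightarrow> real) \<Rightarrow> real \<Rightarrow> ('a \<Rightarrow> real) set" where
  "eigenspace V m c = {x \<in> vecs V. mat_vec V m x = vscale c x}"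

definition eigenvalue :: "'a set \<Rightarrow> ('a \<Rightarrow> 'a \<Rightarrow> real) \<Rightarrow> real \<Rightarrow> bool" where
  "eigenvalue V m c \<longleftrightarrow> (\<exists>x \<in> vecs V. x \<noteq> 0 \<and> mat_vec V m x = vscale c x)"

definition mat_rel :: "'a set \<Rightarrow> ('a \<Rightarrow> 'a \<Rightarrow> real) \<Rightarrow> ('a \<times> 'a) set" where
  "mat_rel V m = {(i, j). i \<in> V \<and> j \<in> V \<and> m i i = m j j \<and> m i j = m j i \<and>
     (\<forall>k \<in> V - {i, j}. m i k = m j k \<and> m k i = m k j)}"

lemma equiv_mat_rel: "equiv V (mat_rel V m)"
proof (rule equivI)
  show "mat_rel V m \<subseteq> V \<times> V" "refl_on V (mat_rel V m)" "sym (mat_rel V m)"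
    by (auto simp: mat_rel_def refl_on_def sym_def)
  show "trans (mat_rel V m)"
  proof (rule transI)
    fix i j k assume ij: "(i, j) \<in> mat_rel V m" and jk: "(j, k) \<in> mat_rel V m"
    show "(i, k) \<in> mat_rel V m"
    proof (cases "i = j \<or> j = k \<or> i = k")
      case True
      then show ?thesis using ij jk by (auto simp: mat_rel_def)
    next
      case False
      have "m i l = m k l \<and> m l i = m l k" if "l \<in> V - {i, k}" for l
        using ij jk that False by (cases "l = j") (auto simp: mat_rel_def)
      moreover have "m i k = m k i"
        using ij jk False by (auto simp: mat_rel_def)
      ultimately show ?thesis using ij jk by (auto simp: mat_rel_def)
    qed
  qed
qed

definition sum_zero_space :: "'a set \<Rightarrow> 'a set \<Rightarrow> ('a \<Rightarrow> real) set" where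
  "sum_zero_space V U = {x \<in> vecs V. {i \<in> V. x i \<noteq> 0} \<subseteq> U \<and> (\<Sum>i\<in>U. x i) = 0}"

end

theory Submission
  imports Defs
begin

text \<open>Two indices are related exactly when swapping them simultaneously in rows and columns
  leaves the matrix unchanged. On an equivalence class \<open>W\<close> the matrix is therefore as symmetric as
  possible: its diagonal entries share one value \<open>a\<close>, its off-diagonal entries share one value \<open>b\<close>,
  and each row indexed outside \<open>W\<close> is constant along \<open>W\<close>. So the \<open>W\<close>-block is
  \<open>(a - b) I + b J\<close> with \<open>J\<close> the all-ones matrix. A vector supported on \<open>W\<close> with coordinate sum zero
  is annihilated by \<open>J\<close> and by every constant row, hence is multiplied by \<open>a - b\<close>. When \<open>W\<close> has two
  elements \<open>p \<noteq> q\<close>, the difference of the two unit vectors is a nonzero vector of this kind, so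
  \<open>a - b\<close> is an eigenvalue.\<close>

lemma related_rows_cols:
  assumes "(i, j) \<in> mat_rel V m" "k \<in> V" "k \<noteq> i" "k \<noteq> j"
  shows "m i k = m j k" "m k i = m k j"
  using assms by (auto simp: mat_rel_def)

lemma related_diagonal: "(i, j) \<in> mat_rel V m \<Longrightarrow> m i i = m j j"
  by (simp add: mat_rel_def)

lemma related_symmetric: "(i, j) \<in> mat_rel V m \<Longrightarrow> m i j = m j i"
  by (simp add: mat_rel_def)

text \<open>Moving the column index within its row, and then the row index within the new column, connects
  any two off-diagonal positions. The first move is blocked only if the new column equals the old
  row; the symmetry of the entry at a related pair then permits starting from the transposed
  position.\<close>

lemma class_offdiagonal_constant:
  assumes rel: "\<And>i j. i \<in> W \<Longrightarrow> j \<in> W \<Longrightarrow> (i, j) \<in> mat_rel V m"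
    and "W \<subseteq> V" "i \<in> W" "j \<in> W" "i \<noteq> j" "k \<in> W" "l \<in> W" "k \<noteq> l"
  shows "m i j = m k l"
proof -
  have main: "m r s = m k l" if "r \<in> W" "s \<in> W" "r \<noteq> s" "l \<noteq> r" for r s
  proof -
    have "m r s = m r l"
      using related_rows_cols(2)[OF rel, of s l r] that \<open>W \<subseteq> V\<close> \<open>l \<in> W\<close> by auto
    also have "m r l = m k l"
      using related_rows_cols(1)[OF rel, of r k l] that \<open>W \<subseteq> V\<close> \<open>k \<in> W\<close> \<open>l \<in> W\<close> \<open>k \<noteq> l\<close> by auto
    finally show ?thesis .
  qed
  show ?thesis
  proof (cases "l = i")
    case True
    then have "m j i = m k l" using main[of j i] assms(3-8) by simp
    then show ?thesis using related_symmetric[OF rel, of i j] assms(3,4) by simp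
  next
    case False
    then show ?thesis using main[of i j] assms(3-5) by simp
  qed
qed

lemma subspace_sum_zero_space: "fun_vs.subspace (sum_zero_space V U)"
proof (rule fun_vs.subspaceI)
  show "0 \<in> sum_zero_space V U"
    by (simp add: sum_zero_space_def vecs_def)
next
  fix x y assume "x \<in> sum_zero_space V U" "y \<in> sum_zero_space V U"
  then show "x + y \<in> sum_zero_space V U"
    by (fastforce simp: sum_zero_space_def vecs_def sum.distrib)
next
  fix c x assume "x \<in> sum_zero_space V U"
  then show "vscale c x \<in> sum_zero_space V U"
    by (auto simp: sum_zero_space_def vecs_def vscale_def simp flip: sum_distrib_left)
qed

text \<open>On vectors supported on the class, row \<open>i\<close> of the matrix acts as a constant row plus, when \<open>i\<close>
  lies in the class, \<open>m p p - m p q\<close> in position \<open>i\<close>. The constant part pairs to zero with a vector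
  of coordinate sum zero.\<close>

lemma class_sum_zero_space_subset_eigenspace:
  assumes "finite V" "W \<subseteq> V"
    and rel: "\<And>i j. i \<in> W \<Longrightarrow> j \<in> W \<Longrightarrow> (i, j) \<in> mat_rel V m"
    and pq: "p \<in> W" "q \<in> W" "p \<noteq> q"
  shows "sum_zero_space V W \<subseteq> eigenspace V m (m p p - m p q)"
proof
  fix x assume x: "x \<in> sum_zero_space V W"
  then have xV: "x \<in> vecs V" and sum0: "(\<Sum>j\<in>W. x j) = 0"
    and outside: "\<And>j. j \<notin> W \<Longrightarrow> x j = 0"
    by (auto simp: sum_zero_space_def vecs_def)
  have "finite W" using assms finite_subset by blast
  have row: "(\<Sum>j\<in>V. m i j * x j) = (m p p - m p q) * x i" if "i \<in> V" for i
  proof -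
    have "(\<Sum>j\<in>V. m i j * x j) = (\<Sum>j\<in>W. m i j * x j)"
      using assms outside by (intro sum.mono_neutral_right) auto
    also have "\<dots> = (m p p - m p q) * x i"
    proof (cases "i \<in> W")
      case True
      have "m i j * x j = m p q * x j + (if j = i then (m p p - m p q) * x i else 0)"
        if "j \<in> W" for j
      proof (cases "j = i")
        case True
        then show ?thesis
          using related_diagonal[OF rel, of i p] \<open>i \<in> W\<close> pq by (simp add: algebra_simps)
      next
        case False
        then show ?thesis
          using class_offdiagonal_constant[OF rel \<open>W \<subseteq> V\<close>, of i j p q] \<open>i \<in> W\<close> that pq by simp
      qed
      then have "(\<Sum>j\<in>W. m i j * x j) =
          (\<Sum>j\<in>W. m p q * x j + (if j = i then (m p p - m p q) * x i else 0))"
        by (intro sum.cong) auto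
      also have "\<dots> = m p q * (\<Sum>j\<in>W. x j) + (m p p - m p q) * x i"
        using True \<open>finite W\<close> by (simp add: sum.distrib sum_distrib_left)
      finally show ?thesis using sum0 by simp
    next
      case False
      have "m i j = m i p" if "j \<in> W" for j
        using related_rows_cols(2)[OF rel, of j p i] that pq False \<open>i \<in> V\<close> by blast
      then have "(\<Sum>j\<in>W. m i j * x j) = m i p * (\<Sum>j\<in>W. x j)"
        by (simp add: sum_distrib_left)
      then show ?thesis using sum0 outside[OF False] by simp
    qed
    finally show ?thesis .
  qed
  have "mat_vec V m x = vscale (m p p - m p q) x"
    using row xV by (auto simp: mat_vec_def vscale_def vecs_def)
  then show "x \<in> eigenspace V m (m p p - m p q)"
    using xV by (simp add: eigenspace_def)
qed

lemma sum_zero_space_nontrivial: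
  assumes "finite U" "U \<subseteq> V" "p \<in> U" "q \<in> U" "p \<noteq> q"
  shows "\<exists>x \<in> sum_zero_space V U. x \<noteq> 0"
proof
  let ?x = "\<lambda>i. (if i = p then 1 else 0) - (if i = q then 1 else 0) :: real"
  show "?x \<in> sum_zero_space V U"
    using assms by (auto simp: sum_zero_space_def vecs_def sum_subtractf)
  show "?x \<noteq> 0"
    using assms by (auto simp: fun_eq_iff intro!: exI[of _ p])
qed

theorem proposition2p3:
  fixes V :: "'a set" and E :: "'a set multiset"
    and m :: "'a \<Rightarrow> 'a \<Rightarrow> real" and W :: "'a set"
  assumes "hypergraph V E"
    and "W \<in> V // mat_rel V m"
    and "card W \<ge> 2"
  shows "\<exists>c. eigenvalue V m c \<and>
    fun_vs.subspace (sum_zero_space V W) \<and>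
    sum_zero_space V W \<subseteq> eigenspace V m c"
proof -
  have "finite V" using assms(1) by (rule hypergraph.finite_vertices)
  have "W \<subseteq> V" using equiv_mat_rel assms(2) by (rule in_quotient_imp_subset)
  have "finite W" using \<open>W \<subseteq> V\<close> \<open>finite V\<close> by (rule finite_subset)
  have rel: "(i, j) \<in> mat_rel V m" if "i \<in> W" "j \<in> W" for i j
    using in_quotient_imp_in_rel[OF equiv_mat_rel assms(2)] that by blast
  obtain p q where pq: "p \<in> W" "q \<in> W" "p \<noteq> q"
    using assms(3) card_le_Suc0_iff_eq[OF \<open>finite W\<close>] by fastforce
  have sub: "sum_zero_space V W \<subseteq> eigenspace V m (m p p - m p q)"
    using \<open>finite V\<close> \<open>W \<subseteq> V\<close> rel pq by (rule class_sum_zero_space_subset_eigenspace)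
  obtain x where "x \<in> sum_zero_space V W" "x \<noteq> 0"
    using sum_zero_space_nontrivial[OF \<open>finite W\<close> \<open>W \<subseteq> V\<close> pq] by blast
  then have "eigenvalue V m (m p p - m p q)"
    using sub by (auto simp: eigenvalue_def eigenspace_def)
  then show ?thesis using sub subspace_sum_zero_space by blast
qed

end
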